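(* Let $d\in\mathbb{N}$ and $\alpha\in(0,1]$. There is a constant $c=c(d,\alpha)>0$ such that the following holds for every $n\in\mathbb{N}$. Let $J$ be a real symmetric $n\times n$ matrix with $J_{ii}=0$ and $\max_i\sum_j|J_{ij}|\le1-\alpha$, and let $q^n$ be the probability measure on $\{-1,+1\}^n$ proportional to $\exp\big(\tfrac12\sum_{i,j}J_{ij}\sigma_i\sigma_j\big)$ (no external field). For any family of real coefficients $a=(a_I)_{I\subset\{1,\ldots,n\},\,|I|=d}$, the $d$-homogeneous polynomial $f(\sigma)=\sum_{|I|=d}a_I\prod_{i\in I}\sigma_i$ satisfies for all $t>0$ \[ q^n(|f-\mathbb{E}_{q^n}f|\ge t)\le 2\exp\Big(-\frac{t^{2/d}}{c\,n\,\|a\|_\infty^{2/d}}\Big), \] where $\|a\|_\infty=\max_{|I|=d}|a_I|$. *)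

theory Defs
  imports Complex_Main "HOL-Library.FuncSet"
begin

definition spins :: "nat \<Rightarrow> (nat \<Rightarrow> real) set" where
  "spins n = PiE {..<n} (\<lambda>_. {-1, 1})"

definition ising_weight :: "(nat \<Rightarrow> nat \<Rightarrow> real) \<Rightarrow> nat \<Rightarrow> (nat \<Rightarrow> real) \<Rightarrow> real" where
  "ising_weight J n \<sigma> = exp (1/2 * (\<Sum>i<n. \<Sum>j<n. J i j * \<sigma> i * \<sigma> j))"

definition ising_Z :: "(nat \<Rightarrow> nat \<Rightarrow> real) \<Rightarrow> nat \<Rightarrow> real" where
  "ising_Z J n = (\<Sum>\<sigma>\<in>spins n. ising_weight J n \<sigma>)"

definition ising_prob :: "(nat \<Rightarrow> nat \<Rightarrow> real) \<Rightarrow> nat \<Rightarrow> ((nat \<Rightarrow> real) \<Rightarrow> bool) \<Rightarrow> real" where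
  "ising_prob J n P = (\<Sum>\<sigma>\<in>{\<sigma>\<in>spins n. P \<sigma>}. ising_weight J n \<sigma>) / ising_Z J n"

definition ising_expect :: "(nat \<Rightarrow> nat \<Rightarrow> real) \<Rightarrow> nat \<Rightarrow> ((nat \<Rightarrow> real) \<Rightarrow> real) \<Rightarrow> real" where
  "ising_expect J n f = (\<Sum>\<sigma>\<in>spins n. ising_weight J n \<sigma> * f \<sigma>) / ising_Z J n"

definition dsubsets :: "nat \<Rightarrow> nat \<Rightarrow> nat set set" where
  "dsubsets n d = {I. I \<subseteq> {..<n} \<and> card I = d}"

definition hom_poly :: "nat \<Rightarrow> nat \<Rightarrow> (nat set \<Rightarrow> real) \<Rightarrow> (nat \<Rightarrow> real) \<Rightarrow> real" where
  "hom_poly n d a \<sigma> = (\<Sum>I\<in>dsubsets n d. a I * (\<Prod>i\<in>I. \<sigma> i))"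

definition coeff_sup_norm :: "nat \<Rightarrow> nat \<Rightarrow> (nat set \<Rightarrow> real) \<Rightarrow> real" where
  "coeff_sup_norm n d a = Max ((\<lambda>I. \<bar>a I\<bar>) ` dsubsets n d)"

end

theory Submission
  imports Defs
begin

text \<open>The proof uses Griffiths-type correlation inequalities and the moment method. By Ginibre's
  duplication trick, every even moment of \<open>f\<close> under \<open>J\<close> is at most the same moment of
  \<open>\<parallel>a\<parallel>\<^sub>\<infinity> S\<^sup>d\<close> under the ferromagnetic couplings \<open>\<bar>J\<bar>\<close>, where \<open>S = \<Sum>\<sigma>\<^sub>i\<close>, because
  \<open>\<parallel>a\<parallel>\<^sub>\<infinity> S\<^sup>d\<close> dominates \<open>f\<close> coefficientwise after reducing with \<open>\<sigma>\<^sub>i\<^sup>2 = 1\<close>.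
  For ferromagnetic couplings,
  \<open>E \<sigma>\<^sub>i S\<^sup>k \<le> \<Sum>\<^sub>j J\<^sub>i\<^sub>j E \<sigma>\<^sub>j S\<^sup>k + k E S\<^sup>k\<^sup>-\<^sup>1\<close>; summing over \<open>i\<close> and using the row sum
  bound gives \<open>\<alpha> E S\<^sup>k\<^sup>+\<^sup>1 \<le> k n E S\<^sup>k\<^sup>-\<^sup>1\<close>, hence Gaussian moments for \<open>S\<close>. Markov's inequality
  with an optimised moment finishes the proof; the mean of \<open>f\<close> is absorbed using the second moment.\<close>

section \<open>Spin configurations: single flips and pointwise products\<close>

lemma finite_spins [simp]: "finite (spins n)"
  by (simp add: spins_def finite_PiE)

lemma spins_nonempty: "spins n \<noteq> {}"
  by (simp add: spins_def PiE_eq_empty_iff)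

lemma spins_values: "\<sigma> \<in> spins n \<Longrightarrow> i < n \<Longrightarrow> \<sigma> i = - 1 \<or> \<sigma> i = 1"
  by (auto simp: spins_def)

lemma spins_square [simp]: "\<sigma> \<in> spins n \<Longrightarrow> i < n \<Longrightarrow> \<sigma> i * \<sigma> i = 1"
  using spins_values by fastforce

lemma spins_uminus_upd:
  assumes "\<sigma> \<in> spins n" "i < n"
  shows "\<sigma>(i := - \<sigma> i) \<in> spins n"
  using assms by (auto simp: spins_def PiE_iff extensional_def)

lemma sum_spins_flip:
  fixes F :: "(nat \<Rightarrow> real) \<Rightarrow> real"
  assumes "i < n"
  shows "(\<Sum>\<sigma>\<in>spins n. F (\<sigma>(i := - \<sigma> i))) = (\<Sum>\<sigma>\<in>spins n. F \<sigma>)"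
  by (rule sum.reindex_bij_witness[where i = "\<lambda>\<sigma>. \<sigma>(i := - \<sigma> i)" and j = "\<lambda>\<sigma>. \<sigma>(i := - \<sigma> i)"])
     (auto simp: assms spins_uminus_upd)

text \<open>The group operation of the hypercube. The restriction keeps the product extensional, so
  that it lies in \<open>spins n\<close> again.\<close>

definition spin_mult :: "nat \<Rightarrow> (nat \<Rightarrow> real) \<Rightarrow> (nat \<Rightarrow> real) \<Rightarrow> nat \<Rightarrow> real" where
  "spin_mult n s \<sigma> = restrict (\<lambda>i. s i * \<sigma> i) {..<n}"

lemma spin_mult_apply [simp]: "i < n \<Longrightarrow> spin_mult n s \<sigma> i = s i * \<sigma> i"
  by (simp add: spin_mult_def)

lemma spin_mult_in_spins:
  assumes "s \<in> spins n" "\<sigma> \<in> spins n"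
  shows "spin_mult n s \<sigma> \<in> spins n"
  unfolding spins_def spin_mult_def
proof (rule restrict_PiE_iff[THEN iffD2], intro ballI)
  fix i assume "i \<in> {..<n}"
  then show "s i * \<sigma> i \<in> {- 1, 1}"
    using spins_values[OF assms(1), of i] spins_values[OF assms(2), of i] by auto
qed

lemma spin_mult_cancel:
  assumes "s \<in> spins n" "\<sigma> \<in> spins n"
  shows "spin_mult n (spin_mult n s \<sigma>) \<sigma> = s"
proof
  fix i
  show "spin_mult n (spin_mult n s \<sigma>) \<sigma> i = s i"
  proof (cases "i < n")
    case True
    then show ?thesis
      using spins_square[OF assms(2) True] by (simp add: mult.assoc)
  next
    case False
    then show ?thesis
      using assms(1) by (simp add: spin_mult_def spins_def PiE_def extensional_def)
  qed
qed

text \<open>Since spins square to 1, multiplying by a fixed configuration is an involution of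
  \<open>spins n\<close>. This is the change of variables in the duplication argument.\<close>

lemma sum_spins_spin_mult:
  fixes F :: "(nat \<Rightarrow> real) \<Rightarrow> real"
  assumes "\<sigma> \<in> spins n"
  shows "(\<Sum>s\<in>spins n. F (spin_mult n s \<sigma>)) = (\<Sum>s\<in>spins n. F s)"
  by (rule sum.reindex_bij_witness[where i = "\<lambda>s. spin_mult n s \<sigma>" and j = "\<lambda>s. spin_mult n s \<sigma>"])
     (auto simp: assms spin_mult_in_spins spin_mult_cancel)

section \<open>The cone of functions with nonnegative Walsh-Fourier coefficients\<close>

text \<open>The inner sums are the Walsh-Fourier coefficients of \<open>H\<close>, up to the factor
  2^n.\<close>

definition fourier_nonneg :: "nat \<Rightarrow> ((nat \<Rightarrow> real) \<Rightarrow> real) \<Rightarrow> bool" where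
  "fourier_nonneg n H \<longleftrightarrow> (\<forall>A\<subseteq>{..<n}. 0 \<le> (\<Sum>\<sigma>\<in>spins n. H \<sigma> * (\<Prod>i\<in>A. \<sigma> i)))"

text \<open>Equivalent to \<^const>\<open>fourier_nonneg\<close>, but in this form closure under products is immediate
  and no Fourier inversion is needed.\<close>

definition pos_type :: "nat \<Rightarrow> ((nat \<Rightarrow> real) \<Rightarrow> real) \<Rightarrow> bool" where
  "pos_type n G \<longleftrightarrow> (\<forall>H. fourier_nonneg n H \<longrightarrow> fourier_nonneg n (\<lambda>\<sigma>. G \<sigma> * H \<sigma>))"

lemma fourier_nonneg_cong:
  assumes "\<And>\<sigma>. \<sigma> \<in> spins n \<Longrightarrow> G \<sigma> = H \<sigma>"
  shows "fourier_nonneg n G \<longleftrightarrow> fourier_nonneg n H"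
  unfolding fourier_nonneg_def using assms by simp

lemma pos_type_cong:
  assumes "\<And>\<sigma>. \<sigma> \<in> spins n \<Longrightarrow> G \<sigma> = H \<sigma>"
  shows "pos_type n G \<longleftrightarrow> pos_type n H"
proof -
  have "fourier_nonneg n (\<lambda>\<sigma>. G \<sigma> * K \<sigma>) \<longleftrightarrow> fourier_nonneg n (\<lambda>\<sigma>. H \<sigma> * K \<sigma>)" for K
    by (rule fourier_nonneg_cong) (simp add: assms)
  then show ?thesis by (simp add: pos_type_def)
qed

lemma pos_type_const: "0 \<le> c \<Longrightarrow> pos_type n (\<lambda>_. c)"
  unfolding pos_type_def fourier_nonneg_def
  by (simp add: mult.assoc flip: sum_distrib_left)

lemma pos_type_add:
  assumes "pos_type n F" "pos_type n G"
  shows "pos_type n (\<lambda>\<sigma>. F \<sigma> + G \<sigma>)"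
  using assms unfolding pos_type_def fourier_nonneg_def
  by (simp add: distrib_right sum.distrib)

lemma pos_type_mult:
  assumes "pos_type n F" "pos_type n G"
  shows "pos_type n (\<lambda>\<sigma>. F \<sigma> * G \<sigma>)"
  using assms unfolding pos_type_def by (simp add: mult.assoc)

lemma pos_type_cmult: "0 \<le> c \<Longrightarrow> pos_type n G \<Longrightarrow> pos_type n (\<lambda>\<sigma>. c * G \<sigma>)"
  by (intro pos_type_mult pos_type_const)

text \<open>Multiplication by one spin permutes the characters: the coefficient of the product at
  \<open>A\<close> is that of \<open>H\<close> at the symmetric difference of \<open>A\<close> and
  {i}, called \<open>B\<close> below.\<close>

lemma pos_type_coordinate:
  assumes i: "i < n"
  shows "pos_type n (\<lambda>\<sigma>. \<sigma> i)"
  unfolding pos_type_def fourier_nonneg_def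
proof (intro allI impI)
  fix H A
  assume H: "\<forall>A\<subseteq>{..<n}. 0 \<le> (\<Sum>\<sigma>\<in>spins n. H \<sigma> * (\<Prod>i\<in>A. \<sigma> i))" and A: "A \<subseteq> {..<n}"
  have fin: "finite A" using A finite_subset by blast
  define B where "B = (if i \<in> A then A - {i} else insert i A)"
  have "\<sigma> i * H \<sigma> * (\<Prod>i\<in>A. \<sigma> i) = H \<sigma> * (\<Prod>i\<in>B. \<sigma> i)" if "\<sigma> \<in> spins n" for \<sigma>
  proof (cases "i \<in> A")
    case True
    have "(\<Prod>i\<in>A. \<sigma> i) = \<sigma> i * (\<Prod>i\<in>B. \<sigma> i)"
      using fin True by (simp add: B_def prod.remove)
    then have "\<sigma> i * H \<sigma> * (\<Prod>i\<in>A. \<sigma> i) = (\<sigma> i * \<sigma> i) * (H \<sigma> * (\<Prod>i\<in>B. \<sigma> i))"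
      by simp
    then show ?thesis using that i by simp
  next
    case False
    then show ?thesis using fin by (simp add: B_def)
  qed
  then have "(\<Sum>\<sigma>\<in>spins n. \<sigma> i * H \<sigma> * (\<Prod>i\<in>A. \<sigma> i))
      = (\<Sum>\<sigma>\<in>spins n. H \<sigma> * (\<Prod>i\<in>B. \<sigma> i))"
    by (rule sum.cong[OF refl])
  moreover have "B \<subseteq> {..<n}" using A i by (auto simp: B_def)
  ultimately show "0 \<le> (\<Sum>\<sigma>\<in>spins n. \<sigma> i * H \<sigma> * (\<Prod>i\<in>A. \<sigma> i))"
    using H by simp
qed

lemma pos_type_sum:
  assumes "\<And>x. x \<in> A \<Longrightarrow> pos_type n (G x)"
  shows "pos_type n (\<lambda>\<sigma>. \<Sum>x\<in>A. G x \<sigma>)"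
  using assms
  by (induction A rule: infinite_finite_induct) (auto intro: pos_type_const pos_type_add)

lemma pos_type_prod:
  assumes "\<And>x. x \<in> A \<Longrightarrow> pos_type n (G x)"
  shows "pos_type n (\<lambda>\<sigma>. \<Prod>x\<in>A. G x \<sigma>)"
  using assms
  by (induction A rule: infinite_finite_induct) (auto intro: pos_type_const pos_type_mult)

lemma pos_type_power: "pos_type n G \<Longrightarrow> pos_type n (\<lambda>\<sigma>. G \<sigma> ^ k)"
  by (induction k) (auto intro: pos_type_const pos_type_mult)

text \<open>Each coefficient is a finite sum over configurations, hence continuous under pointwise
  limits. Together with closure under sums and products this admits power series with nonnegative
  coefficients.\<close>

lemma pos_type_limit:
  assumes "\<And>m. pos_type n (G m)"
    and lim: "\<And>\<sigma>. \<sigma> \<in> spins n \<Longrightarrow> (\<lambda>m. G m \<sigma>) \<longlonglongrightarrow> L \<sigma>"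
  shows "pos_type n L"
  unfolding pos_type_def fourier_nonneg_def
proof (intro allI impI)
  fix H A
  assume H: "\<forall>A\<subseteq>{..<n}. 0 \<le> (\<Sum>\<sigma>\<in>spins n. H \<sigma> * (\<Prod>i\<in>A. \<sigma> i))" and A: "A \<subseteq> {..<n}"
  have "(\<lambda>m. \<Sum>\<sigma>\<in>spins n. G m \<sigma> * H \<sigma> * (\<Prod>i\<in>A. \<sigma> i))
      \<longlonglongrightarrow> (\<Sum>\<sigma>\<in>spins n. L \<sigma> * H \<sigma> * (\<Prod>i\<in>A. \<sigma> i))"
    by (intro tendsto_sum tendsto_mult lim tendsto_const)
  moreover have "0 \<le> (\<Sum>\<sigma>\<in>spins n. G m \<sigma> * H \<sigma> * (\<Prod>i\<in>A. \<sigma> i))" for m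
    using assms(1)[of m] H A unfolding pos_type_def fourier_nonneg_def by blast
  ultimately show "0 \<le> (\<Sum>\<sigma>\<in>spins n. L \<sigma> * H \<sigma> * (\<Prod>i\<in>A. \<sigma> i))"
    by (intro LIMSEQ_le_const) auto
qed

lemma pos_type_sums:
  assumes "pos_type n G" "\<And>m. 0 \<le> c m"
    and "\<And>\<sigma>. \<sigma> \<in> spins n \<Longrightarrow> (\<lambda>m. c m * G \<sigma> ^ m) sums L \<sigma>"
  shows "pos_type n L"
proof (rule pos_type_limit)
  show "pos_type n (\<lambda>\<sigma>. \<Sum>m<N. c m * G \<sigma> ^ m)" for N
    by (intro pos_type_sum pos_type_cmult pos_type_power assms)
qed (use assms(3) in \<open>simp add: sums_def\<close>)

lemma pos_type_exp:
  assumes "pos_type n G"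
  shows "pos_type n (\<lambda>\<sigma>. exp (G \<sigma>))"
proof (rule pos_type_sums[OF assms, where c = "\<lambda>m. inverse (fact m)"])
  show "(\<lambda>m. inverse (fact m) * G \<sigma> ^ m) sums exp (G \<sigma>)" for \<sigma>
    using exp_converges[of "G \<sigma>"] by simp
qed simp

text \<open>For odd m the coefficient is 1/(m-1)! - 1/m! = (m-1)/m!. What matters is its sign: it
  makes the function preserve \<open>pos_type\<close>.\<close>

lemma xcosh_minus_sinh_sums:
  fixes x :: real
  shows "(\<lambda>m. (if odd m then (real m - 1) / fact m else 0) * x ^ m) sums (x * cosh x - sinh x)"
proof -
  let ?f = "\<lambda>m. if odd m then x ^ m * real m / fact m else 0"
  have "(\<lambda>m. x * (if even m then x ^ m /\<^sub>R fact m else 0)) sums (x * cosh x)"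
    by (intro sums_mult cosh_converges)
  moreover have "x * (if even m then x ^ m /\<^sub>R fact m else 0) = ?f (Suc m)" for m
    by (simp add: field_simps del: of_nat_Suc)
  ultimately have "(\<lambda>m. ?f (Suc m)) sums (x * cosh x)" by simp
  then have "?f sums (x * cosh x)"
    by (subst (asm) sums_Suc_iff) simp
  from sums_diff[OF this sinh_converges[of x]]
  show ?thesis
    by (rule sums_cong[THEN iffD1, rotated]) (auto simp: field_simps)
qed

lemma pos_type_xcosh_minus_sinh:
  assumes "pos_type n G"
  shows "pos_type n (\<lambda>\<sigma>. G \<sigma> * cosh (G \<sigma>) - sinh (G \<sigma>))"
proof (rule pos_type_sums[OF assms _ xcosh_minus_sinh_sums])
  show "0 \<le> (if odd m then (real m - 1) / fact m else 0)" for m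
    by (cases m) auto
qed

text \<open>The constant 1 has nonnegative coefficients: flipping a spin in a nonempty
  \<open>A\<close> negates the character, so its sum vanishes. Multiplying by \<open>G\<close> and
  reading off the coefficient at the empty set gives the claim.\<close>

lemma pos_type_sum_nonneg:
  assumes "pos_type n G"
  shows "0 \<le> (\<Sum>\<sigma>\<in>spins n. G \<sigma>)"
proof -
  have "fourier_nonneg n (\<lambda>_. 1)"
    unfolding fourier_nonneg_def
  proof (intro allI impI)
    fix A assume A: "A \<subseteq> {..<n}"
    have fin: "finite A" using A finite_subset by blast
    show "0 \<le> (\<Sum>\<sigma>\<in>spins n. 1 * (\<Prod>i\<in>A. \<sigma> i))"
    proof (cases "A = {}")
      case False
      then obtain i where i: "i \<in> A" by blast
      have "(\<Prod>k\<in>A. (\<sigma>(i := - \<sigma> i)) k) = - (\<Prod>k\<in>A. \<sigma> k)" for \<sigma> :: "nat \<Rightarrow> real"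
        using fin i by (simp add: prod.remove)
      with sum_spins_flip[of i n "\<lambda>\<sigma>. \<Prod>k\<in>A. \<sigma> k"] A i
      show ?thesis by (auto simp: sum_negf)
    qed simp
  qed
  with assms have "fourier_nonneg n (\<lambda>\<sigma>. G \<sigma> * 1)"
    unfolding pos_type_def by blast
  then show ?thesis
    unfolding fourier_nonneg_def by (metis (no_types, lifting) empty_subsetI mult.right_neutral prod.empty sum.cong)
qed

section \<open>Gibbs expectations, Griffiths' inequality and comparison by duplication\<close>

lemma pos_type_ising_weight:
  assumes "\<And>i j. i < n \<Longrightarrow> j < n \<Longrightarrow> 0 \<le> K i j"
  shows "pos_type n (ising_weight K n)"
  unfolding ising_weight_def[abs_def]
  by (intro pos_type_exp pos_type_cmult pos_type_sum pos_type_mult pos_type_const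
      pos_type_coordinate) (auto intro: assms)

lemma ising_weight_pos: "0 < ising_weight J n \<sigma>"
  by (simp add: ising_weight_def)

lemma ising_Z_pos: "0 < ising_Z J n"
  unfolding ising_Z_def by (intro sum_pos ising_weight_pos finite_spins spins_nonempty)

text \<open>Griffiths' first inequality: the ferromagnetic weight is itself of positive type, hence
  so is its product with \<open>G\<close>.\<close>

lemma ising_expect_nonneg:
  assumes "\<And>i j. i < n \<Longrightarrow> j < n \<Longrightarrow> 0 \<le> K i j" "pos_type n G"
  shows "0 \<le> ising_expect K n G"
  unfolding ising_expect_def
  by (intro divide_nonneg_pos ising_Z_pos pos_type_sum_nonneg pos_type_mult
      pos_type_ising_weight assms)

lemma ising_expect_const: "ising_expect J n (\<lambda>_. c) = c"
  using ising_Z_pos[of J n]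
  by (simp add: ising_expect_def ising_Z_def flip: sum_distrib_right)

lemma ising_expect_add:
  "ising_expect J n (\<lambda>\<sigma>. F \<sigma> + G \<sigma>) = ising_expect J n F + ising_expect J n G"
  by (simp add: ising_expect_def distrib_left sum.distrib add_divide_distrib)

lemma ising_expect_cmult: "ising_expect J n (\<lambda>\<sigma>. c * F \<sigma>) = c * ising_expect J n F"
  by (simp add: ising_expect_def sum_distrib_left mult.left_commute)

lemma ising_expect_diff:
  "ising_expect J n (\<lambda>\<sigma>. F \<sigma> - G \<sigma>) = ising_expect J n F - ising_expect J n G"
  using ising_expect_add[of J n F "\<lambda>\<sigma>. - 1 * G \<sigma>"] ising_expect_cmult[of J n "- 1" G] by simp

lemma ising_expect_sum:
  "ising_expect J n (\<lambda>\<sigma>. \<Sum>x\<in>A. F x \<sigma>) = (\<Sum>x\<in>A. ising_expect J n (F x))"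
  by (induction A rule: infinite_finite_induct)
     (simp_all add: ising_expect_const ising_expect_add)

lemma ising_expect_mono:
  assumes "\<And>\<sigma>. \<sigma> \<in> spins n \<Longrightarrow> F \<sigma> \<le> G \<sigma>"
  shows "ising_expect J n F \<le> ising_expect J n G"
  unfolding ising_expect_def
  using ising_Z_pos[of J n] ising_weight_pos[of J n]
  by (intro divide_right_mono sum_mono mult_left_mono assms less_imp_le) auto

text \<open>Ginibre's duplication: for two independent configurations \<open>\<sigma>\<close> under \<open>\<bar>J\<bar>\<close> and \<open>\<sigma>'\<close> under \<open>J\<close>,
  conditioning on \<open>s = \<sigma> \<sigma>'\<close> leaves a ferromagnetic Gibbs weight for \<open>\<sigma>\<close>.\<close>

lemma ising_expect_comparison:
  assumes "\<And>s. s \<in> spins n \<Longrightarrow> pos_type n (\<lambda>\<sigma>. G \<sigma> - F (spin_mult n s \<sigma>))"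
  shows "ising_expect J n F \<le> ising_expect (\<lambda>i j. \<bar>J i j\<bar>) n G"
proof -
  define W where "W = ising_weight J n"
  define W' where "W' = ising_weight (\<lambda>i j. \<bar>J i j\<bar>) n"
  have pos: "pos_type n (\<lambda>\<sigma>. W' \<sigma> * W (spin_mult n s \<sigma>))" if s: "s \<in> spins n" for s
  proof -
    have "W' \<sigma> * W (spin_mult n s \<sigma>)
        = ising_weight (\<lambda>i j. \<bar>J i j\<bar> + J i j * s i * s j) n \<sigma>" for \<sigma>
      unfolding W_def W'_def ising_weight_def exp_add[symmetric]
      by (simp add: sum.distrib algebra_simps)
    \<comment> \<open>The product \<open>s i * s j\<close> is 1 or -1, so the twisted coupling is 0
      or twice the absolute value of \<open>J i j\<close>, whatever the sign of
      \<open>J i j\<close>.\<close>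
    moreover have "0 \<le> \<bar>J i j\<bar> + J i j * s i * s j" if "i < n" "j < n" for i j
      using spins_values[OF s that(1)] spins_values[OF s that(2)] by auto
    ultimately show ?thesis
      using pos_type_ising_weight[of n "\<lambda>i j. \<bar>J i j\<bar> + J i j * s i * s j"] by simp
  qed
  have "0 \<le> (\<Sum>s\<in>spins n. \<Sum>\<sigma>\<in>spins n.
      W' \<sigma> * W (spin_mult n s \<sigma>) * (G \<sigma> - F (spin_mult n s \<sigma>)))"
    by (intro sum_nonneg pos_type_sum_nonneg pos_type_mult pos assms)
  also have "\<dots> = (\<Sum>\<sigma>\<in>spins n. \<Sum>s\<in>spins n.
      W' \<sigma> * W (spin_mult n s \<sigma>) * (G \<sigma> - F (spin_mult n s \<sigma>)))"
    by (rule sum.swap)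
  \<comment> \<open>For each fixed \<sigma> the substitution turns the product of \<sigma> and s
    into a free second configuration, so the double sum factorizes.\<close>
  also have "\<dots> = (\<Sum>\<sigma>\<in>spins n. \<Sum>s\<in>spins n. W' \<sigma> * W s * (G \<sigma> - F s))"
    by (intro sum.cong refl sum_spins_spin_mult[where F = "\<lambda>s. W' _ * W s * (G _ - F s)"])
  also have "\<dots> = (\<Sum>\<sigma>\<in>spins n. W' \<sigma> * G \<sigma>) * (\<Sum>s\<in>spins n. W s)
      - (\<Sum>\<sigma>\<in>spins n. W' \<sigma>) * (\<Sum>s\<in>spins n. W s * F s)"
    unfolding sum_product by (simp add: sum_subtractf right_diff_distrib mult_ac)
  finally have "(\<Sum>\<sigma>\<in>spins n. W \<sigma> * F \<sigma>) * (\<Sum>\<sigma>\<in>spins n. W' \<sigma>)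
      \<le> (\<Sum>\<sigma>\<in>spins n. W' \<sigma> * G \<sigma>) * (\<Sum>\<sigma>\<in>spins n. W \<sigma>)"
    by (simp add: mult.commute)
  then show ?thesis
    using ising_Z_pos[of J n] ising_Z_pos[of "\<lambda>i j. \<bar>J i j\<bar>" n]
    unfolding ising_expect_def ising_Z_def W_def W'_def
    by (simp add: divide_le_eq pos_le_divide_eq)
qed

section \<open>Elementary symmetric polynomials against powers of the magnetization\<close>

lemma finite_dsubsets [simp]: "finite (dsubsets n d)"
  by (rule finite_subset[of _ "Pow {..<n}"]) (auto simp: dsubsets_def)

lemma pos_type_monomial: "I \<in> dsubsets n d \<Longrightarrow> pos_type n (\<lambda>\<sigma>. \<Prod>i\<in>I. \<sigma> i)"
  by (intro pos_type_prod pos_type_coordinate) (auto simp: dsubsets_def)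

text \<open>Every monomial of the elementary symmetric polynomial occurs in the expansion of the
  power. The induction picks one occurrence canonically: a set of size d+1 is coded injectively by
  its minimum and the rest.\<close>

lemma pos_type_magnetization_power_minus_elementary:
  "pos_type n (\<lambda>\<sigma>. (\<Sum>i<n. \<sigma> i) ^ d - (\<Sum>I\<in>dsubsets n d. \<Prod>i\<in>I. \<sigma> i))"
proof (induction d)
  case 0
  have "dsubsets n 0 = {{}}"
    by (auto simp: dsubsets_def dest: finite_subset[OF _ finite_lessThan])
  then show ?case by (simp add: pos_type_const)
next
  case (Suc d)
  let ?S = "\<lambda>\<sigma>::nat \<Rightarrow> real. \<Sum>i<n. \<sigma> i"
  let ?e = "\<lambda>d. \<lambda>\<sigma>::nat \<Rightarrow> real. \<Sum>I\<in>dsubsets n d. \<Prod>i\<in>I. \<sigma> i"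
  let ?h = "\<lambda>I. (Min I, I - {Min I})"
  let ?P = "{..<n} \<times> dsubsets n d"
  have mem: "finite I" "Min I \<in> I" "I \<subseteq> {..<n}" "card I = Suc d"
    if "I \<in> dsubsets n (Suc d)" for I
  proof -
    show *: "I \<subseteq> {..<n}" "card I = Suc d" using that by (auto simp: dsubsets_def)
    then show "finite I" using finite_subset by blast
    then show "Min I \<in> I" using * by (intro Min_in) auto
  qed
  have inj: "inj_on ?h (dsubsets n (Suc d))"
  proof (rule inj_onI)
    fix I I'
    assume *: "I \<in> dsubsets n (Suc d)" "I' \<in> dsubsets n (Suc d)" "?h I = ?h I'"
    have "I = insert (Min I) (I - {Min I})" using mem(2)[OF *(1)] by auto
    also have "\<dots> = (case ?h I of (i, J) \<Rightarrow> insert i J)" by simp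
    also have "\<dots> = insert (Min I') (I' - {Min I'})" unfolding *(3) by simp
    also have "\<dots> = I'" using mem(2)[OF *(2)] by auto
    finally show "I = I'" .
  qed
  have sub: "?h ` dsubsets n (Suc d) \<subseteq> ?P"
  proof (rule image_subsetI)
    fix I assume "I \<in> dsubsets n (Suc d)"
    from mem[OF this] show "?h I \<in> ?P"
      by (auto simp: dsubsets_def card_Diff_singleton simp del: Min_in)
  qed
  \<comment> \<open>The pairs outside the image of \<open>?h\<close>, among them all those with
    \<open>i\<close> in \<open>I\<close>, contribute products of spins with coefficient 1, so the
    remainder is of positive type.\<close>
  have "?S \<sigma> ^ Suc d - ?e (Suc d) \<sigma> = ?S \<sigma> * (?S \<sigma> ^ d - ?e d \<sigma>)
      + (\<Sum>(i, I)\<in>?P - ?h ` dsubsets n (Suc d). \<sigma> i * (\<Prod>k\<in>I. \<sigma> k))" for \<sigma>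
  proof -
    have "?e (Suc d) \<sigma> = (\<Sum>I\<in>dsubsets n (Suc d). case ?h I of (i, I) \<Rightarrow> \<sigma> i * (\<Prod>k\<in>I. \<sigma> k))"
      using mem by (intro sum.cong refl) (simp add: prod.remove)
    also have "\<dots> = (\<Sum>(i, I)\<in>?h ` dsubsets n (Suc d). \<sigma> i * (\<Prod>k\<in>I. \<sigma> k))"
      by (rule sum.reindex_cong[OF inj refl, symmetric]) simp
    finally have e: "?e (Suc d) \<sigma> = \<dots>" .
    have "?S \<sigma> * ?e d \<sigma> = (\<Sum>(i, I)\<in>?P. \<sigma> i * (\<Prod>k\<in>I. \<sigma> k))"
      unfolding sum_product by (rule sum.cartesian_product)
    also have "\<dots> = (\<Sum>(i, I)\<in>?P - ?h ` dsubsets n (Suc d). \<sigma> i * (\<Prod>k\<in>I. \<sigma> k)) + ?e (Suc d) \<sigma>"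
      unfolding e by (rule sum.subset_diff[OF sub]) simp
    finally show ?thesis by (simp add: right_diff_distrib)
  qed
  moreover have "pos_type n (\<lambda>\<sigma>. ?S \<sigma> * (?S \<sigma> ^ d - ?e d \<sigma>)
      + (\<Sum>(i, I)\<in>?P - ?h ` dsubsets n (Suc d). \<sigma> i * (\<Prod>k\<in>I. \<sigma> k)))"
    unfolding case_prod_beta
    by (intro pos_type_add pos_type_mult pos_type_sum Suc.IH pos_type_coordinate
        pos_type_monomial[where d = d]) auto
  ultimately show ?case by simp
qed

section \<open>Gaussian moments of the magnetization under ferromagnetic couplings\<close>

text \<open>Isolates the dependence on spin \<open>i\<close>. By symmetry each pair containing
  \<open>i\<close> occurs twice in the double sum, which cancels the factor 1/2.\<close>

lemma hamiltonian_split: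
  fixes K :: "nat \<Rightarrow> nat \<Rightarrow> real"
  assumes sym: "\<And>j. j < n \<Longrightarrow> K j i = K i j" and diag: "K i i = 0" and i: "i < n"
  shows "1/2 * (\<Sum>k<n. \<Sum>l<n. K k l * \<sigma> k * \<sigma> l)
    = \<sigma> i * (\<Sum>j<n. K i j * \<sigma> j)
      + 1/2 * (\<Sum>k<n. \<Sum>l<n. (if k = i \<or> l = i then 0 else K k l) * \<sigma> k * \<sigma> l)"
proof -
  let ?K = "\<lambda>k l. if k = i \<or> l = i then 0 else K k l"
  have "(\<Sum>k<n. \<Sum>l<n. K k l * \<sigma> k * \<sigma> l)
      = (\<Sum>k<n. \<Sum>l<n. ?K k l * \<sigma> k * \<sigma> l
          + (if k = i then \<sigma> i * (K i l * \<sigma> l) else 0)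
          + (if l = i then \<sigma> i * (K i k * \<sigma> k) else 0))"
  proof (intro sum.cong refl)
    fix k l assume "k \<in> {..<n}" "l \<in> {..<n}"
    then show "K k l * \<sigma> k * \<sigma> l = ?K k l * \<sigma> k * \<sigma> l
          + (if k = i then \<sigma> i * (K i l * \<sigma> l) else 0)
          + (if l = i then \<sigma> i * (K i k * \<sigma> k) else 0)"
      using sym[of k] diag by (cases "k = i"; cases "l = i") simp_all
  qed
  also have "\<dots> = (\<Sum>k<n. \<Sum>l<n. ?K k l * \<sigma> k * \<sigma> l)
      + (\<Sum>l<n. \<Sum>k<n. if k = i then \<sigma> i * (K i l * \<sigma> l) else 0)
      + (\<Sum>k<n. \<Sum>l<n. if l = i then \<sigma> i * (K i k * \<sigma> k) else 0)"
    unfolding sum.distrib by (subst (3) sum.swap) (rule refl)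
  also have "\<dots> = (\<Sum>k<n. \<Sum>l<n. ?K k l * \<sigma> k * \<sigma> l) + 2 * (\<sigma> i * (\<Sum>j<n. K i j * \<sigma> j))"
    using i by (simp add: sum_distrib_left)
  finally show ?thesis by simp
qed

text \<open>Averaging over the \<open>i\<close>-th spin turns \<open>(X - \<sigma>\<^sub>i) exp (\<sigma>\<^sub>i X)\<close>, where \<open>X\<close> is the local field,
  into \<open>X cosh X - sinh X\<close>. This replaces the estimate \<open>tanh x \<le> x\<close>, which is only available
  for \<open>x \<ge> 0\<close>.\<close>

lemma ising_expect_spin_le_neighbours:
  assumes nonneg: "\<And>k l. k < n \<Longrightarrow> l < n \<Longrightarrow> 0 \<le> K k l"
    and sym: "\<And>k l. k < n \<Longrightarrow> l < n \<Longrightarrow> K k l = K l k" and diag: "\<And>k. k < n \<Longrightarrow> K k k = 0"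
    and i: "i < n" and G: "pos_type n G"
    and inv: "\<And>\<sigma>. \<sigma> \<in> spins n \<Longrightarrow> G (\<sigma>(i := - \<sigma> i)) = G \<sigma>"
  shows "ising_expect K n (\<lambda>\<sigma>. \<sigma> i * G \<sigma>)
    \<le> (\<Sum>j<n. K i j * ising_expect K n (\<lambda>\<sigma>. \<sigma> j * G \<sigma>))"
proof -
  define X where "X = (\<lambda>\<sigma>. \<Sum>j<n. K i j * \<sigma> j)"
  define Q where
    "Q = (\<lambda>\<sigma>. 1/2 * (\<Sum>k<n. \<Sum>l<n. (if k = i \<or> l = i then 0 else K k l) * \<sigma> k * \<sigma> l))"
  define T where "T = (\<lambda>\<sigma>. ising_weight K n \<sigma> * ((X \<sigma> - \<sigma> i) * G \<sigma>))"
  have w: "ising_weight K n \<sigma> = exp (Q \<sigma>) * exp (\<sigma> i * X \<sigma>)" for \<sigma>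
    unfolding ising_weight_def X_def Q_def exp_add[symmetric]
    by (subst hamiltonian_split[where K = K and i = i, OF sym diag])
       (simp_all add: i add.commute)
  \<comment> \<open>The zero diagonal keeps the local field free of spin \<open>i\<close>, and
    \<open>Q\<close> omits every pair containing \<open>i\<close>. The flip therefore acts only on
    \<open>\<sigma> i\<close> in the factors exp(\<sigma>_i X) and X - \<sigma>_i of
    \<open>T\<close>.\<close>
  have X: "X (\<sigma>(i := - \<sigma> i)) = X \<sigma>" for \<sigma>
    unfolding X_def by (intro sum.cong refl) (auto simp: diag i)
  have Q: "Q (\<sigma>(i := - \<sigma> i)) = Q \<sigma>" for \<sigma>
    unfolding Q_def by (intro arg_cong[where f = "(*) (1/2)"] sum.cong refl) auto
  have T: "T \<sigma> + T (\<sigma>(i := - \<sigma> i))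
      = 2 * (exp (Q \<sigma>) * G \<sigma> * (X \<sigma> * cosh (X \<sigma>) - sinh (X \<sigma>)))" if "\<sigma> \<in> spins n" for \<sigma>
    unfolding T_def w X Q inv[OF that]
    using spins_values[OF that i]
    by (auto simp: cosh_def sinh_def field_simps)
  have "pos_type n X"
    unfolding X_def
    by (intro pos_type_sum pos_type_cmult pos_type_coordinate) (auto intro: nonneg i)
  moreover have "pos_type n Q"
    unfolding Q_def
    by (intro pos_type_cmult pos_type_sum pos_type_mult pos_type_const pos_type_coordinate)
       (auto intro: nonneg)
  ultimately have "0 \<le> (\<Sum>\<sigma>\<in>spins n. 2 * (exp (Q \<sigma>) * G \<sigma> * (X \<sigma> * cosh (X \<sigma>) - sinh (X \<sigma>))))"
    by (intro pos_type_sum_nonneg pos_type_cmult pos_type_mult pos_type_exp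
        pos_type_xcosh_minus_sinh G) simp_all
  also have "\<dots> = (\<Sum>\<sigma>\<in>spins n. T \<sigma> + T (\<sigma>(i := - \<sigma> i)))"
    by (simp add: T)
  also have "\<dots> = 2 * (\<Sum>\<sigma>\<in>spins n. T \<sigma>)"
    by (simp add: sum.distrib sum_spins_flip[OF i])
  finally have "0 \<le> (\<Sum>\<sigma>\<in>spins n. T \<sigma>)" by simp
  then have "0 \<le> ising_expect K n (\<lambda>\<sigma>. (X \<sigma> - \<sigma> i) * G \<sigma>)"
    using ising_Z_pos[of K n] by (simp add: ising_expect_def T_def)
  also have "(\<lambda>\<sigma>. (X \<sigma> - \<sigma> i) * G \<sigma>) = (\<lambda>\<sigma>. (\<Sum>j<n. K i j * (\<sigma> j * G \<sigma>)) - \<sigma> i * G \<sigma>)"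
    by (simp add: X_def left_diff_distrib sum_distrib_right mult.assoc)
  finally show ?thesis
    by (simp add: ising_expect_diff ising_expect_sum ising_expect_cmult)
qed

text \<open>Writing S^k = A + \<sigma>_i B with A and B free of spin i gives \<sigma>_i S^k =
  \<sigma>_i A + B. The neighbour inequality applies to the first term; the second is dominated
  coefficientwise by k S^(k-1).\<close>

lemma ising_expect_spin_times_magnetization_power:
  assumes nonneg: "\<And>k l. k < n \<Longrightarrow> l < n \<Longrightarrow> 0 \<le> K k l"
    and sym: "\<And>k l. k < n \<Longrightarrow> l < n \<Longrightarrow> K k l = K l k" and diag: "\<And>k. k < n \<Longrightarrow> K k k = 0"
    and i: "i < n"
  shows "ising_expect K n (\<lambda>\<sigma>. \<sigma> i * (\<Sum>l<n. \<sigma> l) ^ k)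
    \<le> (\<Sum>j<n. K i j * ising_expect K n (\<lambda>\<sigma>. \<sigma> j * (\<Sum>l<n. \<sigma> l) ^ k))
      + real k * ising_expect K n (\<lambda>\<sigma>. (\<Sum>l<n. \<sigma> l) ^ (k - 1))"
proof -
  define S where "S = (\<lambda>\<sigma>::nat \<Rightarrow> real. \<Sum>l<n. \<sigma> l)"
  define R where "R = (\<lambda>\<sigma>::nat \<Rightarrow> real. \<Sum>l\<in>{..<n} - {i}. \<sigma> l)"
  \<comment> \<open>\<open>A\<close> and \<open>B\<close> are the even and odd parts in \<epsilon>
    of (R + \<epsilon>)^k at \<epsilon> = 1. The recursions below build both from \<open>R\<close>
    by sums and products, hence they are of positive type.\<close>
  define A where "A = (\<lambda>k \<sigma>. ((R \<sigma> + 1) ^ k + (R \<sigma> - 1) ^ k) / 2)"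
  define B where "B = (\<lambda>k \<sigma>. ((R \<sigma> + 1) ^ k - (R \<sigma> - 1) ^ k) / 2)"
  have A0: "A 0 \<sigma> = 1" and B0: "B 0 \<sigma> = 0" for \<sigma>
    by (simp_all add: A_def B_def)
  have ASuc: "A (Suc k) \<sigma> = R \<sigma> * A k \<sigma> + B k \<sigma>"
    and BSuc: "B (Suc k) \<sigma> = R \<sigma> * B k \<sigma> + A k \<sigma>" for k \<sigma>
    by (simp_all add: A_def B_def field_simps)
  have S: "S \<sigma> = R \<sigma> + \<sigma> i" for \<sigma>
    using i by (simp add: S_def R_def sum.remove[of "{..<n}" i])
  have SAB: "S \<sigma> ^ k = A k \<sigma> + \<sigma> i * B k \<sigma>" if "\<sigma> \<in> spins n" for k \<sigma>
    using spins_values[OF that i] by (auto simp: S A_def B_def field_simps)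
  have R_pos: "pos_type n R" and S_pos: "pos_type n S"
    unfolding R_def S_def by (auto intro: pos_type_sum pos_type_coordinate)
  have AB_pos: "pos_type n (A k) \<and> pos_type n (B k)" for k
  proof (induction k)
    case 0
    show ?case unfolding A0[abs_def] B0[abs_def] by (simp add: pos_type_const)
  next
    case (Suc k)
    then show ?case
      unfolding ASuc[abs_def] BSuc[abs_def] by (intro conjI pos_type_add pos_type_mult R_pos) auto
  qed
  \<comment> \<open>\<open>B k\<close> is a centred difference quotient of the k-th power, to be
    compared with its derivative. For k = 0 the truncated exponent is harmless because the factor
    \<open>real k\<close> vanishes.\<close>
  have D_pos: "pos_type n (\<lambda>\<sigma>. real k * S \<sigma> ^ (k - 1) - B k \<sigma>)" for k
  proof (induction k)
    case 0
    show ?case by (simp add: B0 pos_type_const)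
  next
    case (Suc k)
    have "real (Suc k) * S \<sigma> ^ (Suc k - 1) - B (Suc k) \<sigma>
        = S \<sigma> * (real k * S \<sigma> ^ (k - 1) - B k \<sigma>) + 2 * (\<sigma> i * B k \<sigma>)"
      (is "?l \<sigma> = ?r \<sigma>") if "\<sigma> \<in> spins n" for \<sigma>
    proof -
      have "real k * (S \<sigma> * S \<sigma> ^ (k - 1)) = real k * S \<sigma> ^ k"
        by (cases k) auto
      moreover have "S \<sigma> * B k \<sigma> = R \<sigma> * B k \<sigma> + \<sigma> i * B k \<sigma>"
        by (simp add: S distrib_right)
      ultimately show ?thesis
        using SAB[OF that, of k] by (simp add: BSuc algebra_simps)
    qed
    moreover have "pos_type n ?r"
      using AB_pos[of k] Suc S_pos i
      by (intro pos_type_add pos_type_cmult pos_type_mult pos_type_coordinate) auto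
    ultimately show ?case by (subst pos_type_cong[of n ?l ?r]) auto
  qed
  have mono: "ising_expect K n F \<le> ising_expect K n F'" if "pos_type n (\<lambda>\<sigma>. F' \<sigma> - F \<sigma>)" for F F'
    using ising_expect_nonneg[OF nonneg that] by (simp add: ising_expect_diff)
  have split: "ising_expect K n (\<lambda>\<sigma>. \<sigma> i * S \<sigma> ^ k)
      = ising_expect K n (\<lambda>\<sigma>. \<sigma> i * A k \<sigma>) + ising_expect K n (B k)"
  proof -
    have "\<sigma> i * S \<sigma> ^ k = \<sigma> i * A k \<sigma> + B k \<sigma>" if "\<sigma> \<in> spins n" for \<sigma>
      using spins_values[OF that i] by (auto simp: SAB[OF that])
    then have "ising_expect K n (\<lambda>\<sigma>. \<sigma> i * S \<sigma> ^ k) = ising_expect K n (\<lambda>\<sigma>. \<sigma> i * A k \<sigma> + B k \<sigma>)"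
      by (intro antisym ising_expect_mono) auto
    then show ?thesis by (simp add: ising_expect_add)
  qed
  have "R (\<sigma>(i := - \<sigma> i)) = R \<sigma>" for \<sigma>
    unfolding R_def by (intro sum.cong) auto
  then have "ising_expect K n (\<lambda>\<sigma>. \<sigma> i * A k \<sigma>)
      \<le> (\<Sum>j<n. K i j * ising_expect K n (\<lambda>\<sigma>. \<sigma> j * A k \<sigma>))"
    using AB_pos by (intro ising_expect_spin_le_neighbours nonneg sym diag i) (auto simp: A_def)
  also have "\<dots> \<le> (\<Sum>j<n. K i j * ising_expect K n (\<lambda>\<sigma>. \<sigma> j * S \<sigma> ^ k))"
  proof (intro sum_mono mult_left_mono mono)
    fix j assume j: "j \<in> {..<n}"
    have "\<sigma> j * S \<sigma> ^ k - \<sigma> j * A k \<sigma> = \<sigma> j * (\<sigma> i * B k \<sigma>)" if "\<sigma> \<in> spins n" for \<sigma>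
      by (simp add: SAB[OF that] distrib_left)
    moreover have "pos_type n (\<lambda>\<sigma>. \<sigma> j * (\<sigma> i * B k \<sigma>))"
      using AB_pos[of k] i j by (intro pos_type_mult pos_type_coordinate) auto
    ultimately show "pos_type n (\<lambda>\<sigma>. \<sigma> j * S \<sigma> ^ k - \<sigma> j * A k \<sigma>)"
      by (subst pos_type_cong[where H = "\<lambda>\<sigma>. \<sigma> j * (\<sigma> i * B k \<sigma>)"]) auto
    show "0 \<le> K i j" using i j nonneg by simp
  qed
  finally have "ising_expect K n (\<lambda>\<sigma>. \<sigma> i * A k \<sigma>) \<le> \<dots>" .
  moreover have "ising_expect K n (B k) \<le> ising_expect K n (\<lambda>\<sigma>. real k * S \<sigma> ^ (k - 1))"
    by (intro mono D_pos)
  ultimately show ?thesis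
    using split unfolding S_def by (simp add: ising_expect_cmult)
qed

text \<open>Summing the previous estimate over \<open>i\<close> yields a recursion between moments
  two degrees apart. Iterating it would give the double factorial (2m-1)!!, which is relaxed to
  (2m)^m.\<close>

lemma magnetization_moment:
  fixes \<alpha> :: real
  assumes nonneg: "\<And>k l. k < n \<Longrightarrow> l < n \<Longrightarrow> 0 \<le> K k l"
    and sym: "\<And>k l. k < n \<Longrightarrow> l < n \<Longrightarrow> K k l = K l k" and diag: "\<And>k. k < n \<Longrightarrow> K k k = 0"
    and row: "\<And>i. i < n \<Longrightarrow> (\<Sum>j<n. K i j) \<le> 1 - \<alpha>" and \<alpha>: "0 < \<alpha>"
  shows "ising_expect K n (\<lambda>\<sigma>. (\<Sum>i<n. \<sigma> i) ^ (2 * m)) \<le> (real (2 * m) * real n / \<alpha>) ^ m"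
proof -
  let ?S = "\<lambda>\<sigma>::nat \<Rightarrow> real. \<Sum>l<n. \<sigma> l"
  let ?E = "ising_expect K n"
  have rec: "\<alpha> * ?E (\<lambda>\<sigma>. ?S \<sigma> ^ Suc k) \<le> real n * real k * ?E (\<lambda>\<sigma>. ?S \<sigma> ^ (k - 1))" for k
  proof -
    let ?M = "?E (\<lambda>\<sigma>. ?S \<sigma> ^ Suc k)" and ?L = "real k * ?E (\<lambda>\<sigma>. ?S \<sigma> ^ (k - 1))"
    have M: "?M = (\<Sum>i<n. ?E (\<lambda>\<sigma>. \<sigma> i * ?S \<sigma> ^ k))"
      by (simp add: sum_distrib_right ising_expect_sum)
    \<comment> \<open>Griffiths' inequality makes these expectations nonnegative, so their
      coefficients, the column sums of \<open>K\<close>, may be replaced by the upper bound 1 -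
      \<alpha>. By symmetry column sums are row sums.\<close>
    have E_nonneg: "0 \<le> ?E (\<lambda>\<sigma>. \<sigma> j * ?S \<sigma> ^ k)" if "j < n" for j
      using that by (intro ising_expect_nonneg nonneg pos_type_mult pos_type_power pos_type_sum
          pos_type_coordinate) auto
    have "?M \<le> (\<Sum>i<n. (\<Sum>j<n. K i j * ?E (\<lambda>\<sigma>. \<sigma> j * ?S \<sigma> ^ k)) + ?L)"
      unfolding M by (intro sum_mono ising_expect_spin_times_magnetization_power nonneg sym diag) auto
    also have "\<dots> = (\<Sum>j<n. (\<Sum>i<n. K i j) * ?E (\<lambda>\<sigma>. \<sigma> j * ?S \<sigma> ^ k)) + real n * ?L"
      unfolding sum.distrib sum_distrib_right by (subst sum.swap) simp
    also have "(\<Sum>j<n. (\<Sum>i<n. K i j) * ?E (\<lambda>\<sigma>. \<sigma> j * ?S \<sigma> ^ k))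
        \<le> (\<Sum>j<n. (1 - \<alpha>) * ?E (\<lambda>\<sigma>. \<sigma> j * ?S \<sigma> ^ k))"
    proof (intro sum_mono mult_right_mono E_nonneg)
      fix j assume j: "j \<in> {..<n}"
      then have "(\<Sum>i<n. K i j) = (\<Sum>i<n. K j i)" by (intro sum.cong sym) auto
      then show "(\<Sum>i<n. K i j) \<le> 1 - \<alpha>" using row j by simp
    qed auto
    also have "\<dots> = (1 - \<alpha>) * ?M" unfolding M by (simp add: sum_distrib_left)
    finally show ?thesis by (simp add: algebra_simps)
  qed
  show ?thesis
  proof (induction m)
    case 0
    show ?case by (simp add: ising_expect_const)
  next
    case (Suc m)
    let ?c = "real (2 * Suc m) * real n / \<alpha>"
    \<comment> \<open>Both the new factor 2m+1 and the old base 2m are enlarged to 2m+2, so that all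
      factors become equal.\<close>
    have c: "real n * real (2 * m + 1) / \<alpha> \<le> ?c"
      using \<alpha> by (intro divide_right_mono) (auto simp: algebra_simps)
    have "\<alpha> * ?E (\<lambda>\<sigma>. ?S \<sigma> ^ (2 * Suc m)) \<le> real n * real (2 * m + 1) * ?E (\<lambda>\<sigma>. ?S \<sigma> ^ (2 * m))"
      using rec[of "2 * m + 1"] by simp
    then have "?E (\<lambda>\<sigma>. ?S \<sigma> ^ (2 * Suc m)) \<le> real n * real (2 * m + 1) / \<alpha> * ?E (\<lambda>\<sigma>. ?S \<sigma> ^ (2 * m))"
      using \<alpha> by (simp add: field_simps)
    also have "\<dots> \<le> real n * real (2 * m + 1) / \<alpha> * (real (2 * m) * real n / \<alpha>) ^ m"
      using \<alpha> by (intro mult_left_mono Suc.IH) auto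
    also have "\<dots> \<le> ?c * ?c ^ m"
      using \<alpha> by (intro mult_mono c power_mono divide_right_mono mult_right_mono) auto
    finally show ?case by simp
  qed
qed

section \<open>Even moments of homogeneous polynomials\<close>

text \<open>The hypotheses say that the coefficients of \<open>F\<close> are bounded in absolute
  value by those of \<open>G\<close>. Carrying both signs closes the induction, since each new
  difference or sum is half a sum of products of the old ones.\<close>

lemma pos_type_power_dominated:
  assumes "pos_type n (\<lambda>\<sigma>. G \<sigma> - F \<sigma>)" "pos_type n (\<lambda>\<sigma>. G \<sigma> + F \<sigma>)"
  shows "pos_type n (\<lambda>\<sigma>. G \<sigma> ^ k - F \<sigma> ^ k) \<and> pos_type n (\<lambda>\<sigma>. G \<sigma> ^ k + F \<sigma> ^ k)"
proof (induction k)
  case 0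
  show ?case by (simp add: pos_type_const)
next
  case (Suc k)
  define D where "D = (\<lambda>\<sigma>. G \<sigma> - F \<sigma>)"
  define E where "E = (\<lambda>\<sigma>. G \<sigma> + F \<sigma>)"
  define Dk where "Dk = (\<lambda>\<sigma>. G \<sigma> ^ k - F \<sigma> ^ k)"
  define Ek where "Ek = (\<lambda>\<sigma>. G \<sigma> ^ k + F \<sigma> ^ k)"
  have "(\<lambda>\<sigma>. G \<sigma> ^ Suc k - F \<sigma> ^ Suc k) = (\<lambda>\<sigma>. 1/2 * (D \<sigma> * Ek \<sigma> + E \<sigma> * Dk \<sigma>))"
    and "(\<lambda>\<sigma>. G \<sigma> ^ Suc k + F \<sigma> ^ Suc k) = (\<lambda>\<sigma>. 1/2 * (D \<sigma> * Dk \<sigma> + E \<sigma> * Ek \<sigma>))"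
    by (auto simp: D_def E_def Dk_def Ek_def fun_eq_iff field_simps)
  moreover have "pos_type n D" "pos_type n E" "pos_type n Dk" "pos_type n Ek"
    using Suc assms by (simp_all add: D_def E_def Dk_def Ek_def)
  ultimately show ?case
    by (simp only:) (intro conjI pos_type_cmult pos_type_add pos_type_mult; simp)
qed

text \<open>The elementary symmetric polynomial is interposed. Twisting by \<open>s\<close> only
  changes signs of the \<open>a I\<close>, so the bound \<open>b\<close> on absolute values
  survives.\<close>

lemma pos_type_magnetization_power_minus_hom_poly:
  assumes b: "\<And>I. I \<in> dsubsets n d \<Longrightarrow> \<bar>a I\<bar> \<le> b" and "0 \<le> b" and s: "s \<in> spins n"
  shows "pos_type n (\<lambda>\<sigma>. b * (\<Sum>i<n. \<sigma> i) ^ d - hom_poly n d a (spin_mult n s \<sigma>))"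
proof -
  have "b * (\<Sum>i<n. \<sigma> i) ^ d - hom_poly n d a (spin_mult n s \<sigma>)
      = b * ((\<Sum>i<n. \<sigma> i) ^ d - (\<Sum>I\<in>dsubsets n d. \<Prod>i\<in>I. \<sigma> i))
        + (\<Sum>I\<in>dsubsets n d. (b - a I * (\<Prod>i\<in>I. s i)) * (\<Prod>i\<in>I. \<sigma> i))" for \<sigma>
  proof -
    have "(\<Prod>i\<in>I. spin_mult n s \<sigma> i) = (\<Prod>i\<in>I. s i) * (\<Prod>i\<in>I. \<sigma> i)" if "I \<in> dsubsets n d" for I
      unfolding prod.distrib[symmetric] using that by (intro prod.cong) (auto simp: dsubsets_def)
    then have "hom_poly n d a (spin_mult n s \<sigma>)
        = (\<Sum>I\<in>dsubsets n d. a I * (\<Prod>i\<in>I. s i) * (\<Prod>i\<in>I. \<sigma> i))"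
      by (simp add: hom_poly_def mult.assoc)
    then show ?thesis
      by (simp add: left_diff_distrib right_diff_distrib sum_subtractf sum_distrib_left)
  qed
  moreover have "0 \<le> b - a I * (\<Prod>i\<in>I. s i)" if I: "I \<in> dsubsets n d" for I
  proof -
    have "\<bar>s i\<bar> = 1" if "i \<in> I" for i
      using spins_values[OF s, of i] that I unfolding dsubsets_def by fastforce
    then have "\<bar>a I * (\<Prod>i\<in>I. s i)\<bar> = \<bar>a I\<bar>"
      by (simp add: abs_mult abs_prod)
    with b[OF I] show ?thesis by linarith
  qed
  ultimately show ?thesis
    by (simp only:) (intro pos_type_add pos_type_cmult pos_type_sum pos_type_monomial
      pos_type_magnetization_power_minus_elementary \<open>0 \<le> b\<close>; simp)
qed

text \<open>Duplication passes to absolute couplings and replaces the polynomial by b S^d, whose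
  power 2k is a magnetization moment of order 2dk.\<close>

lemma hom_poly_moment:
  fixes \<alpha> :: real
  assumes sym: "\<And>i j. i < n \<Longrightarrow> j < n \<Longrightarrow> J i j = J j i" and diag: "\<And>i. i < n \<Longrightarrow> J i i = 0"
    and row: "\<And>i. i < n \<Longrightarrow> (\<Sum>j<n. \<bar>J i j\<bar>) \<le> 1 - \<alpha>" and \<alpha>: "0 < \<alpha>"
    and b: "\<And>I. I \<in> dsubsets n d \<Longrightarrow> \<bar>a I\<bar> \<le> b" "0 \<le> b"
  shows "ising_expect J n (\<lambda>\<sigma>. hom_poly n d a \<sigma> ^ (2 * k))
    \<le> b ^ (2 * k) * (real (2 * (d * k)) * real n / \<alpha>) ^ (d * k)"
proof -
  let ?S = "\<lambda>\<sigma>::nat \<Rightarrow> real. \<Sum>i<n. \<sigma> i"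
  have "ising_expect J n (\<lambda>\<sigma>. hom_poly n d a \<sigma> ^ (2 * k))
      \<le> ising_expect (\<lambda>i j. \<bar>J i j\<bar>) n (\<lambda>\<sigma>. (b * ?S \<sigma> ^ d) ^ (2 * k))"
  proof (rule ising_expect_comparison)
    fix s assume s: "s \<in> spins n"
    have "hom_poly n d (\<lambda>I. - a I) \<sigma> = - hom_poly n d a \<sigma>" for \<sigma>
      by (simp add: hom_poly_def sum_negf)
    then have "pos_type n (\<lambda>\<sigma>. b * ?S \<sigma> ^ d + hom_poly n d a (spin_mult n s \<sigma>))"
      using pos_type_magnetization_power_minus_hom_poly[of n d "\<lambda>I. - a I", OF _ b(2) s] b(1) by simp
    with pos_type_magnetization_power_minus_hom_poly[of n d a, OF b s]
    show "pos_type n (\<lambda>\<sigma>. (b * ?S \<sigma> ^ d) ^ (2 * k) - hom_poly n d a (spin_mult n s \<sigma>) ^ (2 * k))"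
      by (rule pos_type_power_dominated[THEN conjunct1])
  qed
  also have "\<dots> = b ^ (2 * k) * ising_expect (\<lambda>i j. \<bar>J i j\<bar>) n (\<lambda>\<sigma>. ?S \<sigma> ^ (2 * (d * k)))"
    by (simp add: power_mult_distrib ising_expect_cmult mult.left_commute flip: power_mult)
  also have "\<dots> \<le> b ^ (2 * k) * (real (2 * (d * k)) * real n / \<alpha>) ^ (d * k)"
    by (intro mult_left_mono magnetization_moment row \<alpha>) (use b(2) in \<open>auto simp: sym diag\<close>)
  finally show ?thesis .
qed

section \<open>Markov's inequality and the tail bound\<close>

text \<open>Markov's inequality for any \<open>F\<close> dominating the indicator of
  \<open>P\<close>; with \<open>F\<close> = 1 it also gives the trivial bound by 1.\<close>

lemma ising_prob_le_expect:
  assumes "\<And>\<sigma>. \<sigma> \<in> spins n \<Longrightarrow> 0 \<le> F \<sigma>"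
    and "\<And>\<sigma>. \<sigma> \<in> spins n \<Longrightarrow> P \<sigma> \<Longrightarrow> 1 \<le> F \<sigma>"
  shows "ising_prob J n P \<le> ising_expect J n F"
proof -
  have w: "0 \<le> ising_weight J n \<sigma>" for \<sigma>
    by (rule less_imp_le[OF ising_weight_pos])
  have "(\<Sum>\<sigma>\<in>{\<sigma>\<in>spins n. P \<sigma>}. ising_weight J n \<sigma>)
      \<le> (\<Sum>\<sigma>\<in>{\<sigma>\<in>spins n. P \<sigma>}. ising_weight J n \<sigma> * F \<sigma>)"
  proof (intro sum_mono)
    fix \<sigma> assume "\<sigma> \<in> {\<sigma>\<in>spins n. P \<sigma>}"
    then show "ising_weight J n \<sigma> \<le> ising_weight J n \<sigma> * F \<sigma>"
      using mult_left_mono[OF assms(2) w, of \<sigma> \<sigma>] by simp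
  qed
  also have "\<dots> \<le> (\<Sum>\<sigma>\<in>spins n. ising_weight J n \<sigma> * F \<sigma>)"
    using w assms(1) by (intro sum_mono2) auto
  finally show ?thesis
    unfolding ising_prob_def ising_expect_def
    using ising_Z_pos[of J n] by (intro divide_right_mono) auto
qed

lemma hom_poly_tail:
  fixes \<alpha> :: real
  assumes sym: "\<And>i j. i < n \<Longrightarrow> j < n \<Longrightarrow> J i j = J j i" and diag: "\<And>i. i < n \<Longrightarrow> J i i = 0"
    and row: "\<And>i. i < n \<Longrightarrow> (\<Sum>j<n. \<bar>J i j\<bar>) \<le> 1 - \<alpha>" and \<alpha>: "0 < \<alpha>"
    and b: "\<And>I. I \<in> dsubsets n d \<Longrightarrow> \<bar>a I\<bar> \<le> b" "0 < b"
    and d: "1 \<le> d" and n: "1 \<le> n" and t: "0 < t"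
  shows "ising_prob J n (\<lambda>\<sigma>. t \<le> \<bar>hom_poly n d a \<sigma> - ising_expect J n (hom_poly n d a)\<bar>)
    \<le> 2 * exp (- (t powr (2 / real d)) / (96 * real d / \<alpha> * real n * b powr (2 / real d)))"
proof -
  define f where "f = hom_poly n d a"
  define m where "m = ising_expect J n f"
  define T where "T = t powr (2 / real d)"
  define B where "B = b powr (2 / real d)"
  define N where "N = 2 * real d * real n / \<alpha>"
  \<comment> \<open>With this scaling B k N / T = k/(12 z), so k of order z makes each Markov factor
    small. The constant 96 is 4 * 12 * 2: a loss of 4 in the exponent, the 12 here, and the 2 in
    \<open>N\<close>.\<close>
  define z where "z = T / (12 * (B * N))"
  let ?P = "\<lambda>\<sigma>. t \<le> \<bar>f \<sigma> - m\<bar>"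
  have powr_d: "(x powr (2 / real d)) ^ d = x\<^sup>2" if "0 < x" for x :: real
    using that d by (simp add: powr_power powr_numeral)
  have T: "0 < T" "T ^ d = t\<^sup>2" and B: "0 < B" "B ^ d = b\<^sup>2"
    using t b(2) powr_d by (auto simp: T_def B_def)
  have N: "0 < N" using d n \<alpha> by (simp add: N_def)
  have z4: "T / (96 * real d / \<alpha> * real n * B) = z / 4"
    unfolding z_def N_def using \<alpha> by (simp add: field_simps)
  have moment: "ising_expect J n (\<lambda>\<sigma>. f \<sigma> ^ (2 * k)) \<le> ((B * (real k * N)) ^ d) ^ k" for k
  proof -
    have "b ^ (2 * k) * (real (2 * (d * k)) * real n / \<alpha>) ^ (d * k) = (b\<^sup>2) ^ k * ((real k * N) ^ d) ^ k"
      by (simp add: N_def mult_ac flip: power_mult)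
    also have "\<dots> = ((B * (real k * N)) ^ d) ^ k"
      by (simp add: power_mult_distrib flip: B(2))
    finally show ?thesis
      using hom_poly_moment[of n J \<alpha> d a, OF sym diag row \<alpha> b(1) less_imp_le[OF b(2)], of k]
      unfolding f_def by simp
  qed
  have "ising_prob J n ?P \<le> 2 * exp (- z / 4)"
  proof (cases "z < 2")
    case True
    have "ising_prob J n ?P \<le> ising_expect J n (\<lambda>_. 1)"
      by (rule ising_prob_le_expect) auto
    also have "\<dots> = 1" by (rule ising_expect_const)
    also have "1 \<le> 2 * exp (- z / 4)"
      \<comment> \<open>The bound is trivial here: 2 (1 - z/4) exceeds 1 when z < 2.\<close>
      using exp_ge_add_one_self[of "- z / 4"] True by linarith
    finally show ?thesis .
  next
    case False
    define k where "k = nat \<lfloor>z\<rfloor>"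
    have k: "real k \<le> z" "z / 2 \<le> real k"
      using False unfolding k_def by linarith+
    \<comment> \<open>The mean is controlled by the second moment. As z is at least 2, B N is at
      most T/24, which forces |m| to be at most t/2; a deviation by t then implies that |f| is at
      least t/2.\<close>
    have "m\<^sup>2 \<le> ising_expect J n (\<lambda>\<sigma>. f \<sigma> ^ 2)"
    proof -
      have "ising_expect J n (\<lambda>_. 0) \<le> ising_expect J n (\<lambda>\<sigma>. (f \<sigma> ^ 2 - 2 * m * f \<sigma>) + m\<^sup>2)"
      proof (rule ising_expect_mono)
        show "0 \<le> (f \<sigma> ^ 2 - 2 * m * f \<sigma>) + m\<^sup>2" for \<sigma>
          using zero_le_power2[of "f \<sigma> - m"] by (simp add: power2_diff algebra_simps)
      qed
      also have "\<dots> = ising_expect J n (\<lambda>\<sigma>. f \<sigma> ^ 2) - m\<^sup>2"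
        by (simp add: ising_expect_add ising_expect_diff ising_expect_cmult ising_expect_const
            flip: m_def) (simp add: power2_eq_square)
      finally show ?thesis by (simp add: ising_expect_const)
    qed
    also have "\<dots> \<le> (B * N) ^ d" using moment[of 1] by simp
    also have "\<dots> \<le> (T / 24) ^ d"
      using False B N unfolding z_def by (intro power_mono) (auto simp: field_simps)
    also have "\<dots> \<le> T ^ d / 4"
      unfolding power_divide using self_le_power[of "24::real" d] d T(1) by (intro frac_le) auto
    also have "\<dots> = (t / 2)\<^sup>2" by (simp add: T power_divide)
    finally have m: "\<bar>m\<bar> \<le> t / 2"
      using t abs_le_square_iff[of m "t / 2"] by simp
    have "ising_prob J n ?P \<le> ising_expect J n (\<lambda>\<sigma>. (4 / t\<^sup>2) ^ k * f \<sigma> ^ (2 * k))"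
    proof (rule ising_prob_le_expect)
      fix \<sigma> assume "t \<le> \<bar>f \<sigma> - m\<bar>"
      with m have "t / 2 \<le> \<bar>f \<sigma>\<bar>" by linarith
      then have "(t / 2)\<^sup>2 \<le> (f \<sigma>)\<^sup>2"
        using t abs_le_square_iff[of "t / 2" "f \<sigma>"] by simp
      then have "1 \<le> 4 / t\<^sup>2 * (f \<sigma>)\<^sup>2"
        using t by (simp add: field_simps)
      then have "1 \<le> (4 / t\<^sup>2 * (f \<sigma>)\<^sup>2) ^ k" by (rule one_le_power)
      then show "1 \<le> (4 / t\<^sup>2) ^ k * f \<sigma> ^ (2 * k)"
        by (simp only: power_mult power_mult_distrib)
    qed (simp add: power_mult)
    also have "\<dots> \<le> (4 / t\<^sup>2) ^ k * ((B * (real k * N)) ^ d) ^ k"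
      unfolding ising_expect_cmult by (intro mult_left_mono moment) simp
    also have "\<dots> = (4 * (B * (real k * N) / T) ^ d) ^ k"
      unfolding power_mult_distrib[symmetric] by (simp add: power_divide T)
    \<comment> \<open>Each of the k factors is at most 4/12 = 1/3, which is below exp(-1) because e
      is at most 3.\<close>
    also have "\<dots> \<le> (exp (- 1)) ^ k"
    proof (rule power_mono)
      have "B * (real k * N) / T \<le> 1 / 12"
        using k(1) T B N unfolding z_def by (simp add: field_simps)
      then have "(B * (real k * N) / T) ^ d \<le> (1 / 12) ^ d"
        using T B N by (intro power_mono) auto
      also have "\<dots> \<le> 1 / 12"
        using power_decreasing[OF d, of "1 / 12 :: real"] by simp
      finally have "4 * (B * (real k * N) / T) ^ d \<le> 1 / 3" by simp
      also have "\<dots> \<le> exp (- 1)"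
        using exp_le by (simp add: exp_minus field_simps)
      finally show "4 * (B * (real k * N) / T) ^ d \<le> exp (- 1)" .
    qed (use T B N in simp)
    also have "\<dots> = exp (- real k)"
      by (simp flip: exp_of_nat_mult)
    also have "\<dots> \<le> exp (- z / 4)" using k False by simp
    also have "\<dots> \<le> 2 * exp (- z / 4)" by simp
    finally show ?thesis .
  qed
  moreover have "- T / (96 * real d / \<alpha> * real n * B) = - z / 4"
    using z4 by (simp only: minus_divide_left[symmetric])
  ultimately show ?thesis
    unfolding f_def m_def T_def B_def by (simp only:)
qed

theorem theorem1p3:
  fixes d :: nat and \<alpha> :: real
  assumes "d \<ge> 1" and "0 < \<alpha>" and "\<alpha> \<le> 1"
  shows "\<exists>c>0. \<forall>(n::nat) (J::nat \<Rightarrow> nat \<Rightarrow> real) (a::nat set \<Rightarrow> real).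
           (\<forall>i<n. \<forall>j<n. J i j = J j i) \<and> (\<forall>i<n. J i i = 0) \<and>
           (\<forall>i<n. (\<Sum>j<n. \<bar>J i j\<bar>) \<le> 1 - \<alpha>) \<longrightarrow>
           (\<forall>t>0. ising_prob J n
                    (\<lambda>\<sigma>. \<bar>hom_poly n d a \<sigma> - ising_expect J n (hom_poly n d a)\<bar> \<ge> t)
                  \<le> 2 * exp (- (t powr (2 / real d)) /
                        (c * real n * coeff_sup_norm n d a powr (2 / real d))))"
proof (intro exI[of _ "96 * real d / \<alpha>"] conjI allI impI)
  show "0 < 96 * real d / \<alpha>" using assms by simp
  fix n :: nat and J :: "nat \<Rightarrow> nat \<Rightarrow> real" and a :: "nat set \<Rightarrow> real" and t :: real
  assume J: "(\<forall>i<n. \<forall>j<n. J i j = J j i) \<and> (\<forall>i<n. J i i = 0) \<and>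
      (\<forall>i<n. (\<Sum>j<n. \<bar>J i j\<bar>) \<le> 1 - \<alpha>)" and t: "0 < t"
  let ?b = "coeff_sup_norm n d a"
  let ?P = "\<lambda>\<sigma>. t \<le> \<bar>hom_poly n d a \<sigma> - ising_expect J n (hom_poly n d a)\<bar>"
  let ?rhs = "2 * exp (- (t powr (2 / real d)) / (96 * real d / \<alpha> * real n * ?b powr (2 / real d)))"
  have b: "\<bar>a I\<bar> \<le> ?b" if "I \<in> dsubsets n d" for I
    unfolding coeff_sup_norm_def using that by (intro Max_ge) auto
  \<comment> \<open>With no index sets the \<open>Max\<close> defining \<open>?b\<close> is taken
    over the empty set and carries no information, but the polynomial is zero and no deviation by t
    > 0 occurs.\<close>
  show "ising_prob J n ?P \<le> ?rhs"
  proof (cases "dsubsets n d = {}")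
    case True
    then have "hom_poly n d a = (\<lambda>_. 0)" by (simp add: hom_poly_def fun_eq_iff)
    then have "ising_prob J n ?P = 0"
      using t by (simp add: ising_prob_def ising_expect_const)
    then show ?thesis by simp
  next
    case False
    then obtain I where I: "I \<in> dsubsets n d" by blast
    have n: "1 \<le> n"
      using I assms(1) card_mono[of "{..<n}" I] by (auto simp: dsubsets_def)
    \<comment> \<open>If \<open>?b\<close> is 0, the denominator is 0 and division by zero yields 0,
      so the right-hand side is 2 and the trivial bound suffices.\<close>
    show ?thesis
    proof (cases "?b = 0")
      case True
      have "ising_prob J n ?P \<le> ising_expect J n (\<lambda>_. 1)"
        by (rule ising_prob_le_expect) auto
      then show ?thesis by (simp add: True ising_expect_const)
    next
      case False
      with b[OF I] have "0 < ?b" by linarith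
      with J t n assms b show ?thesis by (intro hom_poly_tail) auto
    qed
  qed
qed

end
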